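(* Let $q\ge 2$ and $d\ge 1$ be integers and let $\mathbb{T}_{q+1}$ be the infinite $(q+1)$-regular tree. Let $\{\mu_u^n\}_{u,n}$ be a family of finitely supported probability measures on its vertices such that $\mu_u^n(v)=\mu_{u'}^n(v')$ whenever $\operatorname{dist}(u,v)=\operatorname{dist}(u',v')$, and write $g(\ell,n):=\mu_u^n(v)$ for $\operatorname{dist}(u,v)=\ell$. Let $X,Y$ be vertices with $\operatorname{dist}(X,Y)=d$. Then $W_1(\mu_X^n,\mu_Y^n)=S_1+S_2+S_3$, where \[ S_1 = 2 \sum_{h=0}^{\infty} q^h \left( g(h,n) - g(h+d, n) \right) \left( \tfrac{d}{2} + h \right),\qquad S_2 = 2 \sum_{i=1}^{\lfloor d/2 \rfloor} \left( g(i,n) - g(d-i,n) \right) \left( \tfrac{d}{2} - i \right), \] \[ S_3 = 2 \sum_{i=1}^{\lfloor d/2 \rfloor} \sum_{h=1}^{\infty} (q-1) q^{h-1} \left( g(i+h,n) - g(d-i+h,n) \right) \left( \tfrac{d}{2} - i + h \right). \]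
   Context: $W_1(\mu,\nu)$ is the $1$-Wasserstein distance: the minimum over couplings $\pi\ge0$ on $V\times V$ with marginals $\mu,\nu$ of $\sum_{v,w}\operatorname{dist}(v,w)\pi(v,w)$, where $\operatorname{dist}$ is graph distance. *)

theory Defs
  imports "HOL-Probability.Probability" "Graph_Theory.Graph_Theory"
begin

text \<open>
  A simple graph is a symmetric loop-free pair digraph, each undirected edge being represented by
  its two orientations. The predicate \<^const>\<open>tree\<close> of the library is not usable for such graphs:
  it forbids every directed cycle, hence also the cycle of length 2 running back and forth along
  an edge. Cycles of the undirected graph are the directed cycles of length at least 3.
  A \<open>k\<close>-regular tree with \<open>k \<ge> 2\<close> is automatically infinite.
\<close>

definition regular_tree :: "nat \<Rightarrow> 'a pair_pre_digraph \<Rightarrow> bool" where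
  "regular_tree k G \<longleftrightarrow>
     pair_bidirected_digraph G \<and>
     Digraph_Component.connected (with_proj G) \<and>
     \<not> (\<exists>p. pre_digraph.cycle (with_proj G) p \<and> length p \<ge> 3) \<and>
     (\<forall>v \<in> pverts G. finite (out_arcs (with_proj G) v) \<and> out_degree (with_proj G) v = k)"

definition graph_dist :: "'a pair_pre_digraph \<Rightarrow> 'a \<Rightarrow> 'a \<Rightarrow> nat" where
  "graph_dist G u v = (LEAST k. \<exists>p. pre_digraph.awalk (with_proj G) u p v \<and> length p = k)"

definition couplings :: "'a pmf \<Rightarrow> 'a pmf \<Rightarrow> ('a \<times> 'a) pmf set" where
  "couplings \<mu> \<nu> = {\<pi>. map_pmf fst \<pi> = \<mu> \<and> map_pmf snd \<pi> = \<nu>}"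

definition transport_cost :: "'a pair_pre_digraph \<Rightarrow> ('a \<times> 'a) pmf \<Rightarrow> real" where
  "transport_cost G \<pi> = measure_pmf.expectation \<pi> (\<lambda>(v, w). real (graph_dist G v w))"

text \<open>
  Integrability excludes couplings of infinite cost, to which the Bochner integral would assign
  the value 0; it holds for every coupling of finitely supported measures. The use of \<open>LEAST\<close>
  (rather than an infimum) means that an actual minimum is asserted.
\<close>

definition W1 :: "'a pair_pre_digraph \<Rightarrow> 'a pmf \<Rightarrow> 'a pmf \<Rightarrow> real" where
  "W1 G \<mu> \<nu> = (LEAST c. \<exists>\<pi> \<in> couplings \<mu> \<nu>.
     integrable (measure_pmf \<pi>) (\<lambda>(v, w). real (graph_dist G v w)) \<and> c = transport_cost G \<pi>)"

end

theory Submission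
  imports Defs
begin

text \<open>
  On a tree the transport problem is solved by a flow: the net flow through an edge is the difference
  of the masses that the two measures put on one of its sides. A branch hanging off an edge at
  distance \<open>m\<close> from the centre has mass \<open>G m = (\<Sum>k. q ^ k * g (m + k))\<close>, and
  \<open>G m = g m + q * G (m + 1)\<close> makes \<open>G\<close> decreasing although \<open>g\<close> need not be. With
  \<open>g 0 + (q + 1) * G 1 = 1\<close>, hence \<open>G 1 \<le> 1 / 2\<close>, this shows that every edge carries its flow
  in the direction in which the signed distance \<open>f\<close> to the midpoint of the geodesic from
  \<open>X\<close> to \<open>Y\<close> decreases. The flow therefore yields a coupling that moves mass only along geodesics on
  which \<open>f\<close> drops at unit speed; as \<open>f\<close> is 1-Lipschitz, this coupling is optimal and
  \<open>W1\<close> is the difference of the integrals of \<open>f\<close>. Summing \<open>f\<close> over the vertices sorted by their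
  projection to the geodesic and their height above it gives the three series.
\<close>

section \<open>Couplings from flows\<close>

text \<open>The new measure comes from a kernel that fixes every point except \<open>v\<close>, from
  which it jumps to \<open>w\<close> with a suitable probability. Reflexivity of \<open>R\<close>
  accounts for the mass that stays.\<close>

lemma rel_pmf_move_mass:
  fixes \<mu> :: "'a pmf"
  assumes c: "0 \<le> c" "c \<le> pmf \<mu> v" and "v \<noteq> w" and R: "reflp R" "R v w"
  obtains \<mu>' where "rel_pmf R \<mu> \<mu>'"
    "\<And>x. pmf \<mu>' x = pmf \<mu> x - (if x = v then c else 0) + (if x = w then c else 0)"
proof -
  \<comment> \<open>If \<open>pmf \<mu> v = 0\<close> then also \<open>c = 0\<close>, and division
    by zero gives \<open>p = 0\<close>, so \<open>p * pmf \<mu> v = c\<close> holds in every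
    case.\<close>
  define p where "p = c / pmf \<mu> v"
  have p: "0 \<le> p" "p \<le> 1" "p * pmf \<mu> v = c"
    using c by (auto simp: p_def divide_le_eq_1 pmf_nonneg)
  define K where
    "K y = (if y = v then map_pmf (\<lambda>b. if b then w else v) (bernoulli_pmf p) else return_pmf y)" for y
  have "rel_pmf R (bind_pmf \<mu> return_pmf) (bind_pmf \<mu> K)"
  proof (rule rel_pmf_bindI)
    show "rel_pmf (=) \<mu> \<mu>" by (simp add: pmf.rel_eq)
    show "rel_pmf R (return_pmf x) (K y)" if "x = y" for x y
      using that R by (auto simp: K_def rel_pmf_return_pmf1 reflp_def)
  qed
  then have rel: "rel_pmf R \<mu> (bind_pmf \<mu> K)"
    by (simp add: bind_return_pmf')
  have K: "pmf (K y) x = indicator {x} y + p * (indicator {w} x - indicator {v} x) * indicator {v} y" for x y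
  proof (cases "y = v")
    case True
    have "(\<lambda>b. if b then w else v) -` {x} =
        (if x = w then {True} else if x = v then {False} else {})"
      using \<open>v \<noteq> w\<close> by (auto split: if_splits)
    then have "pmf (K y) x = (if x = w then p else if x = v then 1 - p else 0)"
      using True p by (simp add: K_def pmf_map measure_pmf_single)
    then show ?thesis using True \<open>v \<noteq> w\<close> by (auto simp: indicator_def)
  qed (auto simp: K_def indicator_def)
  have "pmf (bind_pmf \<mu> K) x = pmf \<mu> x - (if x = v then c else 0) + (if x = w then c else 0)" for x
  proof -
    have "pmf (bind_pmf \<mu> K) x =
        (\<integral>y. indicator {x} y + p * (indicator {w} x - indicator {v} x) * indicator {v} y \<partial>measure_pmf \<mu>)"
      by (simp add: pmf_bind K)
    also have "\<dots> = pmf \<mu> x + p * (indicator {w} x - indicator {v} x) * pmf \<mu> v"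
    proof (subst Bochner_Integration.integral_add)
      have "integrable (measure_pmf \<mu>) (indicat_real A)" for A
        by (rule integrable_real_indicator) (auto simp: measure_pmf.emeasure_finite less_top[symmetric])
      then show "integrable (measure_pmf \<mu>) (indicat_real {x})"
        "integrable (measure_pmf \<mu>)
          (\<lambda>y. p * (indicator {w} x - indicator {v} x) * indicat_real {v} y)"
        by auto
    qed (simp add: measure_pmf_single)
    also have "\<dots> = pmf \<mu> x - (if x = v then c else 0) + (if x = w then c else 0)"
      using p(3) \<open>v \<noteq> w\<close> by (auto simp: indicator_def algebra_simps)
    finally show ?thesis .
  qed
  with rel that show thesis by blast
qed

text \<open>
  Along an edge that carries flow and whose tail has maximal \<open>f\<close>, the tail receives no flow,
  so it holds enough mass to send the whole flow of that edge to the head at once.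
\<close>

lemma flow_imp_rel_pmf:
  fixes \<mu> \<nu> :: "'a pmf" and \<phi> :: "'a \<Rightarrow> 'a \<Rightarrow> real" and f :: "'a \<Rightarrow> real"
  assumes "finite B"
    and "\<And>v w. 0 \<le> \<phi> v w"
    and "\<And>v w. \<phi> v w \<noteq> 0 \<Longrightarrow> v \<in> B \<and> w \<in> B \<and> R v w"
    and "\<And>v. pmf \<mu> v - pmf \<nu> v = (\<Sum>w\<in>B. \<phi> v w) - (\<Sum>w\<in>B. \<phi> w v)"
    and R: "\<And>v w. R v w \<Longrightarrow> f w < f v"
  shows "rel_pmf R\<^sup>*\<^sup>* \<mu> \<nu>"
  using assms(2-4)
\<comment> \<open>The induction is on the number of edges that carry flow. Emptying one edge changes
  \<open>\<mu>\<close> and \<open>\<phi>\<close> while the target \<open>\<nu>\<close> stays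
  fixed.\<close>
proof (induction "card {(v, w). \<phi> v w \<noteq> 0}" arbitrary: \<mu> \<phi> rule: less_induct)
  case less
  define S where "S = {(v, w). \<phi> v w \<noteq> 0}"
  have fin: "finite S"
    by (rule finite_subset[of _ "B \<times> B"]) (use less.prems(2) \<open>finite B\<close> in \<open>auto simp: S_def\<close>)
  show ?case
  proof (cases "S = {}")
    case True
    then have "\<phi> v w = 0" for v w by (auto simp: S_def)
    then have "\<mu> = \<nu>" using less.prems(3) by (intro pmf_eqI) simp
    then show ?thesis by (simp add: rel_pmf_reflI)
  next
    case False
    have "finite (f ` fst ` S)" "f ` fst ` S \<noteq> {}" using fin False by auto
    then have "Max (f ` fst ` S) \<in> f ` fst ` S" by (rule Max_in)
    then obtain v w where vw: "(v, w) \<in> S" and "Max (f ` fst ` S) = f v" by auto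
    then have max: "f a \<le> f v" if "(a, b) \<in> S" for a b
      using that fin Max_ge[of "f ` fst ` S" "f a"] by force
    have vw': "v \<in> B" "w \<in> B" "R v w" "\<phi> v w \<noteq> 0" using vw less.prems(2) by (auto simp: S_def)
    have "v \<noteq> w" using R[OF vw'(3)] by auto
    have "\<phi> u v = 0" for u
      using max[of u v] R[of u v] less.prems(2)[of u v] by (fastforce simp: S_def)
    then have "pmf \<mu> v = pmf \<nu> v + (\<Sum>x\<in>B. \<phi> v x)" using less.prems(3)[of v] by simp
    moreover have "\<phi> v w \<le> (\<Sum>x\<in>B. \<phi> v x)"
      using vw' \<open>finite B\<close> less.prems(1) by (intro member_le_sum) auto
    ultimately have mass: "\<phi> v w \<le> pmf \<mu> v" by (simp add: add_increasing)
    obtain \<mu>' where \<mu>': "rel_pmf R\<^sup>*\<^sup>* \<mu> \<mu>'"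
      "\<And>x. pmf \<mu>' x = pmf \<mu> x - (if x = v then \<phi> v w else 0) + (if x = w then \<phi> v w else 0)"
      by (rule rel_pmf_move_mass[of "\<phi> v w" \<mu> v w "R\<^sup>*\<^sup>*"])
        (use mass less.prems(1) \<open>v \<noteq> w\<close> vw'(3) in \<open>auto simp: reflp_def\<close>)
    define \<phi>' where "\<phi>' x y = (if x = v \<and> y = w then 0 else \<phi> x y)" for x y
    have S': "{(x, y). \<phi>' x y \<noteq> 0} = S - {(v, w)}" by (auto simp: \<phi>'_def S_def)
    have "rel_pmf R\<^sup>*\<^sup>* \<mu>' \<nu>"
    proof (rule less.hyps)
      show "card {(x, y). \<phi>' x y \<noteq> 0} < card {(x, y). \<phi> x y \<noteq> 0}"
        unfolding S' S_def[symmetric] by (rule card_Diff1_less[OF fin vw])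
      show "0 \<le> \<phi>' x y" for x y using less.prems(1) by (simp add: \<phi>'_def)
      show "x \<in> B \<and> y \<in> B \<and> R x y" if "\<phi>' x y \<noteq> 0" for x y
        using that less.prems(2)[of x y] by (auto simp: \<phi>'_def split: if_splits)
      fix x
      have "\<phi>' x y = \<phi> x y - (if y = w then if x = v then \<phi> v w else 0 else 0)" for y
        by (simp add: \<phi>'_def)
      then have "(\<Sum>y\<in>B. \<phi>' x y) = (\<Sum>y\<in>B. \<phi> x y) - (if x = v then \<phi> v w else 0)"
        using \<open>finite B\<close> vw' by (simp add: sum_subtractf)
      moreover have "\<phi>' y x = \<phi> y x - (if y = v then if x = w then \<phi> v w else 0 else 0)" for y
        by (simp add: \<phi>'_def)
      then have "(\<Sum>y\<in>B. \<phi>' y x) = (\<Sum>y\<in>B. \<phi> y x) - (if x = w then \<phi> v w else 0)"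
        using \<open>finite B\<close> vw' by (simp add: sum_subtractf)
      ultimately show "pmf \<mu>' x - pmf \<nu> x = (\<Sum>y\<in>B. \<phi>' x y) - (\<Sum>y\<in>B. \<phi>' y x)"
        using less.prems(3)[of x] by (simp add: \<mu>'(2))
    qed
    with \<mu>'(1) have "rel_pmf (R\<^sup>*\<^sup>* OO R\<^sup>*\<^sup>*) \<mu> \<nu>"
      by (auto simp: pmf.rel_compp)
    then show ?thesis by (rule pmf.rel_mono_strong) auto
  qed
qed

text \<open>The easy half of Kantorovich duality: every coupling gives \<open>f v - f w\<close> the
  same expectation, and \<open>lip\<close> bounds this from above by the cost. On the support of the
  coupling provided by \<open>rel\<close> the opposite inequality holds, so the minimum is attained
  there.\<close>

lemma W1_eqI:
  fixes f :: "'a \<Rightarrow> real"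
  assumes fin: "finite (set_pmf \<mu>)" "finite (set_pmf \<nu>)"
    and lip: "\<And>v w. v \<in> set_pmf \<mu> \<Longrightarrow> w \<in> set_pmf \<nu> \<Longrightarrow> f v - f w \<le> real (graph_dist G v w)"
    and rel: "rel_pmf (\<lambda>v w. real (graph_dist G v w) \<le> f v - f w) \<mu> \<nu>"
  shows "W1 G \<mu> \<nu> = measure_pmf.expectation \<mu> f - measure_pmf.expectation \<nu> f"
proof -
  let ?c = "\<lambda>(v, w). real (graph_dist G v w)"
  have coupling: "set_pmf \<pi> \<subseteq> set_pmf \<mu> \<times> set_pmf \<nu>" "\<And>h :: 'a \<times> 'a \<Rightarrow> real. integrable (measure_pmf \<pi>) h"
    "measure_pmf.expectation \<pi> (\<lambda>(v, w). f v - f w) =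
      measure_pmf.expectation \<mu> f - measure_pmf.expectation \<nu> f"
    if "\<pi> \<in> couplings \<mu> \<nu>" for \<pi>
  proof -
    have m: "map_pmf fst \<pi> = \<mu>" "map_pmf snd \<pi> = \<nu>" using that by (auto simp: couplings_def)
    show sub: "set_pmf \<pi> \<subseteq> set_pmf \<mu> \<times> set_pmf \<nu>"
      unfolding m[symmetric] by (force simp: set_map_pmf)
    have "finite (set_pmf \<pi>)" using sub fin by (meson finite_SigmaI finite_subset)
    then show int: "integrable (measure_pmf \<pi>) h" for h :: "'a \<times> 'a \<Rightarrow> real"
      by (rule integrable_measure_pmf_finite)
    show "measure_pmf.expectation \<pi> (\<lambda>(v, w). f v - f w) =
        measure_pmf.expectation \<mu> f - measure_pmf.expectation \<nu> f"
      unfolding m[symmetric] by (simp add: case_prod_beta' int)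
  qed
  have lower: "measure_pmf.expectation \<mu> f - measure_pmf.expectation \<nu> f \<le> transport_cost G \<pi>"
    if "\<pi> \<in> couplings \<mu> \<nu>" for \<pi>
    unfolding transport_cost_def coupling(3)[OF that, symmetric]
    using coupling(1,2)[OF that] lip by (intro integral_mono_AE) (auto simp: AE_measure_pmf_iff)
  from rel obtain \<pi> where \<pi>: "\<And>v w. (v, w) \<in> set_pmf \<pi> \<Longrightarrow> real (graph_dist G v w) \<le> f v - f w"
    "\<pi> \<in> couplings \<mu> \<nu>"
    by (auto simp: couplings_def elim: rel_pmf.cases)
  have "transport_cost G \<pi> \<le> measure_pmf.expectation \<mu> f - measure_pmf.expectation \<nu> f"
    unfolding transport_cost_def coupling(3)[OF \<pi>(2), symmetric]
    using coupling(2)[OF \<pi>(2)] \<pi>(1) by (intro integral_mono_AE) (auto simp: AE_measure_pmf_iff)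
  with lower[OF \<pi>(2)] have eq: "measure_pmf.expectation \<mu> f - measure_pmf.expectation \<nu> f = transport_cost G \<pi>"
    by simp
  show ?thesis
    unfolding W1_def
  proof (rule Least_equality)
    show "\<exists>\<pi>\<in>couplings \<mu> \<nu>. integrable (measure_pmf \<pi>) ?c \<and>
        measure_pmf.expectation \<mu> f - measure_pmf.expectation \<nu> f = transport_cost G \<pi>"
      using \<pi>(2) eq coupling(2)[OF \<pi>(2)] by blast
  qed (use lower in auto)
qed

section \<open>Distances in regular trees\<close>

locale regular_tree_graph =
  fixes q :: nat and T :: "'a pair_pre_digraph"
  assumes regular_tree: "regular_tree (q + 1) T"
begin

abbreviation V :: "'a set" where "V \<equiv> pverts T"
abbreviation adj :: "'a \<Rightarrow> 'a \<Rightarrow> bool" where "adj u v \<equiv> (u, v) \<in> parcs T"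
abbreviation D :: "'a \<Rightarrow> 'a \<Rightarrow> nat" where "D \<equiv> graph_dist T"
abbreviation nbrs :: "'a \<Rightarrow> 'a set" where "nbrs v \<equiv> {w. adj v w}"

sublocale pair_bidirected_digraph T
  using regular_tree by (simp add: regular_tree_def)

lemma adj_sym: "adj u v \<Longrightarrow> adj v u"
  by (rule arcs_symmetric)

lemma adj_neq: "adj u v \<Longrightarrow> u \<noteq> v"
  using pair_no_loops by fastforce

lemma finite_nbrs: "v \<in> V \<Longrightarrow> finite (nbrs v)"
  and card_nbrs: "v \<in> V \<Longrightarrow> card (nbrs v) = q + 1"
proof -
  assume "v \<in> V"
  then have out: "finite (out_arcs (with_proj T) v)" "card (out_arcs (with_proj T) v) = q + 1"
    using regular_tree by (auto simp: regular_tree_def out_degree_def)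
  have eq: "out_arcs (with_proj T) v = Pair v ` nbrs v"
    by (auto simp: out_arcs_def)
  have inj: "inj_on (Pair v) (nbrs v)"
    by (auto simp: inj_on_def)
  show "finite (nbrs v)" using out(1) eq inj by (simp add: finite_image_iff)
  show "card (nbrs v) = q + 1" using out(2) eq inj by (simp add: card_image)
qed

text \<open>Relation powers compose and reverse more easily than lists of arcs, so distances are
  handled through them. The empty walk is what requires \<open>u \<in> V\<close>.\<close>

lemma relpowp_adj_iff_awalk:
  assumes "u \<in> V"
  shows "(adj ^^ m) u v \<longleftrightarrow> (\<exists>p. awalk u p v \<and> length p = m)"
  using assms
proof (induction m arbitrary: u)
  case 0
  then show ?case by (auto simp: awalk_Nil_iff)
next
  case (Suc m)
  have "(adj ^^ Suc m) u v \<longleftrightarrow> (\<exists>w. adj u w \<and> (adj ^^ m) w v)"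
    by (blast intro: relpowp_Suc_I2 dest: relpowp_Suc_D2)
  also have "\<dots> \<longleftrightarrow> (\<exists>w. adj u w \<and> (\<exists>p. awalk w p v \<and> length p = m))"
    using Suc.IH in_arcsD2 by blast
  also have "\<dots> \<longleftrightarrow> (\<exists>p. awalk u p v \<and> length p = Suc m)" (is "?L \<longleftrightarrow> ?R")
  proof
    assume ?L
    then obtain w p where "adj u w" "awalk w p v" "length p = m" by blast
    then have "awalk u ((u, w) # p) v \<and> length ((u, w) # p) = Suc m"
      using Suc.prems by (simp add: awalk_Cons_iff)
    then show ?R by blast
  next
    assume ?R
    then obtain e p where "awalk u (e # p) v" "length p = m"
      by (metis length_Suc_conv)
    then show ?L
      by (cases e) (auto simp: awalk_Cons_iff)
  qed
  finally show ?case .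
qed

section \<open>The graph metric and geodesics\<close>

lemma dist_eq_Least: "u \<in> V \<Longrightarrow> D u v = (LEAST m. (adj ^^ m) u v)"
  by (simp add: graph_dist_def relpowp_adj_iff_awalk)

lemma dist_le: "u \<in> V \<Longrightarrow> (adj ^^ m) u v \<Longrightarrow> D u v \<le> m"
  by (simp add: dist_eq_Least Least_le)

lemma relpowp_dist:
  assumes "u \<in> V" "v \<in> V"
  shows "(adj ^^ D u v) u v"
proof -
  \<comment> \<open>Connectedness refers to the symmetric closure; as every arc has its reverse, it
    already yields directed walks.\<close>
  have "strongly_connected (with_proj T)"
    using regular_tree pair_sym_arcs symmetric_connected_imp_strongly_connected
    by (auto simp: regular_tree_def)
  then have "u \<rightarrow>\<^sup>*\<^bsub>with_proj T\<^esub> v"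
    using assms by (auto simp: strongly_connected_def)
  then obtain p where "awalk u p v"
    using reachable_awalk by auto
  then have "(adj ^^ length p) u v"
    using relpowp_adj_iff_awalk[OF assms(1)] by blast
  then show ?thesis
    unfolding dist_eq_Least[OF assms(1)] by (rule LeastI)
qed

lemma dist_self [simp]: "u \<in> V \<Longrightarrow> D u u = 0"
  using dist_le[of u 0 u] by simp

lemma dist_eq_0_iff: "u \<in> V \<Longrightarrow> v \<in> V \<Longrightarrow> D u v = 0 \<longleftrightarrow> u = v"
  using relpowp_dist[of u v] by auto

lemma dist_triangle:
  assumes "u \<in> V" "v \<in> V" "w \<in> V"
  shows "D u w \<le> D u v + D v w"
  by (intro dist_le relpowp_trans[OF relpowp_dist relpowp_dist] assms)

lemma relpowp_adj_sym: "(adj ^^ m) u v \<Longrightarrow> (adj ^^ m) v u"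
proof (induction m arbitrary: v)
  case (Suc m)
  then obtain w where "(adj ^^ m) u w" "adj w v" by auto
  then show ?case using Suc.IH adj_sym by (blast intro: relpowp_Suc_I2)
qed simp

lemma dist_commute: "u \<in> V \<Longrightarrow> v \<in> V \<Longrightarrow> D u v = D v u"
  by (meson antisym dist_le relpowp_adj_sym relpowp_dist)

lemma dist_adj:
  assumes "adj u v"
  shows "D u v = 1"
proof -
  have "u \<in> V" "v \<in> V" "u \<noteq> v" using assms in_arcsD1 in_arcsD2 adj_neq by auto
  moreover have "D u v \<le> 1"
    by (rule dist_le[OF \<open>u \<in> V\<close>]) (use assms in \<open>auto simp: relcompp_apply\<close>)
  ultimately show ?thesis using dist_eq_0_iff[of u v] by linarith
qed

lemma dist_adj_le:
  assumes "u \<in> V" "adj v w"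
  shows "D u w \<le> D u v + 1"
  using dist_triangle[of u v w] dist_adj[OF assms(2)] in_arcsD1[OF assms(2)] in_arcsD2[OF assms(2)] assms(1)
  by simp

text \<open>On a walk of minimal length, \<open>x i\<close> is reached in \<open>i\<close> steps,
  and a shorter way to \<open>x i\<close> would shorten the whole walk.\<close>

lemma geodesic:
  assumes "u \<in> V" "v \<in> V"
  obtains x where "x 0 = u" "x (D u v) = v" "\<And>i. i < D u v \<Longrightarrow> adj (x i) (x (Suc i))"
    "\<And>i. i \<le> D u v \<Longrightarrow> D u (x i) = i"
proof -
  obtain x where x: "x 0 = u" "x (D u v) = v" "\<And>i. i < D u v \<Longrightarrow> adj (x i) (x (Suc i))"
    using relpowp_dist[OF assms] unfolding relpowp_fun_conv by blast
  have up: "D u (x j) \<le> D u (x i) + (j - i)" if "i \<le> j" "j \<le> D u v" for i j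
    using that
  proof (induction j)
    case (Suc j)
    show ?case
    proof (cases "i = Suc j")
      case False
      then show ?thesis
        using Suc dist_adj_le[OF assms(1) x(3)[of j]] by simp
    qed simp
  qed simp
  have "D u (x i) = i" if "i \<le> D u v" for i
    using up[of 0 i] up[of i "D u v"] that x assms by simp
  with x that show thesis by blast
qed

lemma closer_neighbour_exists:
  assumes "u \<in> V" "v \<in> V" "u \<noteq> v"
  obtains w where "adj v w" "D u v = Suc (D u w)"
proof -
  obtain x where x: "x 0 = u" "x (D u v) = v" "\<And>i. i < D u v \<Longrightarrow> adj (x i) (x (Suc i))"
    "\<And>i. i \<le> D u v \<Longrightarrow> D u (x i) = i"
    using geodesic[OF assms(1,2)] by blast
  have "D u v \<noteq> 0" using dist_eq_0_iff assms by simp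
  then obtain m where m: "D u v = Suc m" using not0_implies_Suc by blast
  show thesis
    using that[of "x m"] x(2) x(3)[of m] x(4)[of m] m by (auto intro: adj_sym)
qed

text \<open>Two equal vertices of the walk at minimal index distance enclose a cycle.\<close>

lemma nonbacktracking_walk_not_closed:
  assumes adj: "\<And>i. i < n \<Longrightarrow> adj (x i) (x (Suc i))"
    and nb: "\<And>i. Suc (Suc i) \<le> n \<Longrightarrow> x i \<noteq> x (Suc (Suc i))"
    and "0 < n"
  shows "x 0 \<noteq> x n"
proof
  assume "x 0 = x n"
  define P where "P m \<longleftrightarrow> 0 < m \<and> (\<exists>i. i + m \<le> n \<and> x i = x (i + m))" for m
  have "P n" using \<open>0 < n\<close> \<open>x 0 = x n\<close> by (auto simp: P_def)
  define m where "m = (LEAST m. P m)"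
  have "P m" using \<open>P n\<close> unfolding m_def by (rule LeastI)
  then obtain i where i: "0 < m" "i + m \<le> n" "x i = x (i + m)" by (auto simp: P_def)
  have least: "\<not> P l" if "l < m" for l using that not_less_Least unfolding m_def by blast
  have "m \<noteq> 1" using adj[of i] i adj_neq by fastforce
  moreover have "m \<noteq> 2" using nb[of i] i by auto
  ultimately have "3 \<le> m" using i(1) by linarith
  have walk: "pcas (x a) (map (\<lambda>j. (x j, x (Suc j))) [a..<a + l]) (x (a + l)) \<and>
      pawalk_verts (x a) (map (\<lambda>j. (x j, x (Suc j))) [a..<a + l]) = map x [a..<Suc (a + l)]" for a l
  proof (induction l arbitrary: a)
    case (Suc l)
    have "[a..<a + Suc l] = a # [Suc a..<Suc a + l]" by (simp add: upt_conv_Cons)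
    then show ?case using Suc[of "Suc a"] by (simp add: upt_conv_Cons del: upt_Suc)
  qed simp
  define p where "p = map (\<lambda>j. (x j, x (Suc j))) [i..<i + m]"
  have "awalk (x i) p (x i)"
    using walk[of i m] i adj[of i] in_arcsD1 adj
    by (auto simp: awalk_def p_def)
  \<comment> \<open>Two indices in this range differ by less than \<open>m\<close>, so minimality of
    \<open>m\<close> forbids a repetition. The index \<open>i\<close> is left out because
    \<open>x i = x (i + m)\<close>.\<close>
  moreover have "inj_on x {Suc i..i + m}"
  proof (rule linorder_inj_onI')
    fix a b assume "a \<in> {Suc i..i + m}" "b \<in> {Suc i..i + m}" "a < b"
    then show "x a \<noteq> x b"
      using least[of "b - a"] i(2) spec[of "\<lambda>j. j + (b - a) \<le> n \<longrightarrow> x j \<noteq> x (j + (b - a))" a]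
      unfolding P_def by auto
  qed
  then have "distinct (tl (pawalk_verts (x i) p))"
    using walk[of i m] by (auto simp: p_def distinct_map upt_conv_Cons atLeastLessThanSuc_atLeastAtMost simp del: upt_Suc)
  moreover have "length p = m" by (simp add: p_def)
  ultimately have "cycle p" using i(1) by (auto simp: cycle_def)
  with \<open>3 \<le> m\<close> \<open>length p = m\<close> show False
    using regular_tree by (auto simp: regular_tree_def)
qed

text \<open>If both walks began at one vertex, going out along \<open>x\<close>, across the edge and
  back along \<open>y\<close> would be a closed walk. It never backtracks: inside each walk the
  distances to \<open>u\<close> differ, and \<open>x'\<close> and \<open>y'\<close> exclude a
  reversal at the edge. The start needs no such check, being no interior index of the walk.\<close>

lemma geodesics_not_closed_by_edge:
  assumes x: "\<And>i. i < m \<Longrightarrow> adj (x i) (x (Suc i))" "\<And>i. i \<le> m \<Longrightarrow> D u (x i) = i"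
    and y: "\<And>i. i < l \<Longrightarrow> adj (y i) (y (Suc i))" "\<And>i. i \<le> l \<Longrightarrow> D u (y i) = i"
    and edge: "adj (x m) (y l)"
    and x': "\<And>i. m = Suc i \<Longrightarrow> x i \<noteq> y l" and y': "\<And>i. l = Suc i \<Longrightarrow> y i \<noteq> x m"
  shows "x 0 \<noteq> y 0"
proof -
  \<comment> \<open>At \<open>i = m + 1\<close> the index into \<open>y\<close> is \<open>l\<close>,
    at the final \<open>i = m + l + 1\<close> it is \<open>0\<close>.\<close>
  define z where "z i = (if i \<le> m then x i else y (m + l + 1 - i))" for i
  have "z 0 \<noteq> z (m + l + 1)"
  proof (rule nonbacktracking_walk_not_closed)
    fix i assume i: "i < m + l + 1"
    consider "i < m" | "i = m" | "m < i" by linarith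
    then show "adj (z i) (z (Suc i))"
    proof cases
      case 3
      then have "m + l + 1 - i = Suc (m + l + 1 - Suc i)" "m + l + 1 - Suc i < l" using i by auto
      with 3 show ?thesis using y(1)[of "m + l + 1 - Suc i"] by (auto simp: z_def intro: adj_sym)
    qed (use x(1) edge in \<open>auto simp: z_def\<close>)
  next
    fix i assume i: "Suc (Suc i) \<le> m + l + 1"
    consider "Suc (Suc i) \<le> m" | "Suc i = m" | "i = m" | "m < i" by linarith
    then show "z i \<noteq> z (Suc (Suc i))"
    proof cases
      case 1
      then show ?thesis using x(2)[of i] x(2)[of "Suc (Suc i)"] by (auto simp: z_def)
    next
      case 2
      then show ?thesis using x'[of i] by (auto simp: z_def)
    next
      case 3
      then show ?thesis using y'[of "l - 1"] i by (auto simp: z_def)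
    next
      case 4
      then have "D u (z i) = m + l + 1 - i" "D u (z (Suc (Suc i))) = m + l + 1 - Suc (Suc i)"
        using y(2)[of "m + l + 1 - i"] y(2)[of "m + l + 1 - Suc (Suc i)"] i by (simp_all add: z_def)
      moreover have "m + l + 1 - i \<noteq> m + l + 1 - Suc (Suc i)" using i by linarith
      ultimately show ?thesis by metis
    qed
  qed simp
  then show ?thesis by (auto simp: z_def)
qed

text \<open>A tree is bipartite: geodesics from \<open>u\<close> to two adjacent vertices at equal
  distance would be closed up by the edge.\<close>

lemma dist_adj_neq:
  assumes "u \<in> V" "adj v w"
  shows "D u v \<noteq> D u w"
proof
  assume eq: "D u v = D u w"
  have V: "v \<in> V" "w \<in> V" using assms in_arcsD1 in_arcsD2 by auto
  obtain x where x: "x 0 = u" "x (D u v) = v" "\<And>i. i < D u v \<Longrightarrow> adj (x i) (x (Suc i))"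
    "\<And>i. i \<le> D u v \<Longrightarrow> D u (x i) = i"
    using geodesic[OF assms(1) V(1)] by blast
  obtain y where y: "y 0 = u" "y (D u w) = w" "\<And>i. i < D u w \<Longrightarrow> adj (y i) (y (Suc i))"
    "\<And>i. i \<le> D u w \<Longrightarrow> D u (y i) = i"
    using geodesic[OF assms(1) V(2)] by blast
  have "x 0 \<noteq> y 0"
  proof (rule geodesics_not_closed_by_edge[OF x(3,4) y(3,4)])
    show "adj (x (D u v)) (y (D u w))" using x y assms by simp
    show "x i \<noteq> y (D u w)" if "D u v = Suc i" for i
      using x(4)[of i] y(2) that eq by auto
    show "y i \<noteq> x (D u v)" if "D u w = Suc i" for i
      using y(4)[of i] x(2) that eq by auto
  qed
  with x y show False by simp
qed

text \<open>Extending a geodesic to \<open>w\<close> by \<open>v\<close> gives a geodesic to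
  \<open>v\<close>. The edge from \<open>v\<close> to a second closer neighbour \<open>w'\<close>
  would join it to a geodesic ending at \<open>w'\<close>.\<close>

lemma closer_neighbour_unique:
  assumes "u \<in> V" "adj v w" "adj v w'" "D u v = Suc (D u w)" "D u v = Suc (D u w')"
  shows "w = w'"
proof (rule ccontr)
  assume "w \<noteq> w'"
  have V: "w \<in> V" "w' \<in> V" using assms in_arcsD2 by auto
  define m where "m = D u w"
  obtain x where x: "x 0 = u" "x (D u w) = w" "\<And>i. i < D u w \<Longrightarrow> adj (x i) (x (Suc i))"
    "\<And>i. i \<le> D u w \<Longrightarrow> D u (x i) = i"
    using geodesic[OF assms(1) V(1)] by blast
  obtain y where y: "y 0 = u" "y (D u w') = w'" "\<And>i. i < D u w' \<Longrightarrow> adj (y i) (y (Suc i))"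
    "\<And>i. i \<le> D u w' \<Longrightarrow> D u (y i) = i"
    using geodesic[OF assms(1) V(2)] by blast
  define x' where "x' = x(Suc m := v)"
  have "x' 0 \<noteq> y 0"
  proof (rule geodesics_not_closed_by_edge[where m = "Suc m"])
    show "adj (x' i) (x' (Suc i))" if "i < Suc m" for i
      using that x(2) x(3)[of i] assms(2) by (auto simp: x'_def m_def less_Suc_eq intro: adj_sym)
    show "D u (x' i) = i" if "i \<le> Suc m" for i
      using that x(4)[of i] assms(4) by (auto simp: x'_def m_def)
    show "adj (x' (Suc m)) (y (D u w'))" using y assms by (simp add: x'_def)
    show "x' i \<noteq> y (D u w')" if "Suc m = Suc i" for i
      using that x(2) y(2) \<open>w \<noteq> w'\<close> by (auto simp: x'_def m_def)
    show "y i \<noteq> x' (Suc m)" if "D u w' = Suc i" for i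
      using that y(4)[of i] assms(5) by (auto simp: x'_def)
  qed (fact y(3,4))+
  with x y show False by (simp add: x'_def)
qed

lemma dist_adj_cases:
  assumes "u \<in> V" "adj v w"
  obtains "D u v = Suc (D u w)" | "D u w = Suc (D u v)"
  using dist_adj_neq[OF assms] dist_adj_le[OF assms] dist_adj_le[OF assms(1) adj_sym[OF assms(2)]]
  by linarith

section \<open>Counting neighbours and spheres\<close>

lemma card_closer:
  assumes "u \<in> V" "v \<in> V"
  shows "card {w. adj v w \<and> D u v = Suc (D u w)} = (if v = u then 0 else 1)"
proof (cases "v = u")
  case False
  then obtain w where "adj v w" "D u v = Suc (D u w)"
    using closer_neighbour_exists[of u v] assms by metis
  then have "{w. adj v w \<and> D u v = Suc (D u w)} = {w}"
    using closer_neighbour_unique[OF assms(1)] by blast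
  then show ?thesis using False by simp
qed (use assms in simp)

lemma card_farther:
  assumes "u \<in> V" "v \<in> V"
  shows "card {w. adj v w \<and> D u w = Suc (D u v)} = (if v = u then q + 1 else q)"
proof -
  let ?A = "{w. adj v w \<and> D u v = Suc (D u w)}" and ?B = "{w. adj v w \<and> D u w = Suc (D u v)}"
  have un: "?A \<union> ?B = nbrs v"
    using dist_adj_cases[OF assms(1)] by blast
  have "finite ?A" "finite ?B" by (auto intro: finite_subset[OF _ finite_nbrs[OF assms(2)]])
  then have "card (?A \<union> ?B) = card ?A + card ?B"
    by (rule card_Un_disjoint) auto
  then have "card ?A + card ?B = q + 1"
    unfolding un card_nbrs[OF assms(2)] by simp
  with card_closer[OF assms] show ?thesis by (simp split: if_splits)
qed

text \<open>The sets \<open>W v\<close> are disjoint because a vertex has only one neighbour closer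
  to \<open>u\<close>. This is the common induction step for counting spheres and layers.\<close>

lemma card_UN_farther:
  assumes "u \<in> V" "finite A" "A \<subseteq> V"
    and "\<And>v w. v \<in> A \<Longrightarrow> w \<in> W v \<Longrightarrow> adj v w \<and> D u w = Suc (D u v)"
    and "\<And>v. v \<in> A \<Longrightarrow> card (W v) = m"
  shows "finite (\<Union>v\<in>A. W v)" "card (\<Union>v\<in>A. W v) = m * card A"
proof -
  have fin: "finite (W v)" if "v \<in> A" for v
    by (rule finite_subset[OF _ finite_nbrs[of v]]) (use that assms in auto)
  then show "finite (\<Union>v\<in>A. W v)" using assms(2) by blast
  have "W v \<inter> W v' = {}" if "v \<in> A" "v' \<in> A" "v \<noteq> v'" for v v'
  proof (rule ccontr)
    assume "W v \<inter> W v' \<noteq> {}"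
    then obtain w where "w \<in> W v" "w \<in> W v'" by blast
    then show False
      using closer_neighbour_unique[OF assms(1), of w v v'] assms(4)[of v w] assms(4)[of v' w] that
      by (auto intro: adj_sym)
  qed
  then show "card (\<Union>v\<in>A. W v) = m * card A"
    using assms(2,5) fin by (subst card_UN_disjoint) auto
qed

definition sphere :: "'a \<Rightarrow> nat \<Rightarrow> 'a set" where
  "sphere u m = {v \<in> V. D u v = m}"

lemma sphere_Suc:
  assumes "u \<in> V"
  shows "sphere u (Suc m) = (\<Union>v\<in>sphere u m. {w. adj v w \<and> D u w = Suc (D u v)})"
proof (intro equalityI subsetI)
  fix w assume "w \<in> sphere u (Suc m)"
  then have w: "w \<in> V" "D u w = Suc m" by (auto simp: sphere_def)
  then have "u \<noteq> w" using assms by auto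
  then obtain v where "adj w v" "D u w = Suc (D u v)"
    using closer_neighbour_exists[OF assms w(1)] by metis
  then show "w \<in> (\<Union>v\<in>sphere u m. {w. adj v w \<and> D u w = Suc (D u v)})"
    using w in_arcsD2 by (auto simp: sphere_def intro: adj_sym)
qed (use in_arcsD2 in \<open>auto simp: sphere_def\<close>)

lemma sphere_0: "u \<in> V \<Longrightarrow> sphere u 0 = {u}"
  by (auto simp: sphere_def dist_eq_0_iff)

text \<open>Radius \<open>0\<close> is exceptional: the centre has \<open>q + 1\<close> farther
  neighbours, every other vertex has \<open>q\<close>.\<close>

lemma card_sphere_Suc:
  assumes "u \<in> V"
  shows "finite (sphere u (Suc m)) \<and> card (sphere u (Suc m)) = (q + 1) * q ^ m"
proof (induction m)
  case 0
  show ?case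
    using card_UN_farther[OF assms, of "sphere u 0" "\<lambda>v. {w. adj v w \<and> D u w = Suc (D u v)}" "q + 1"]
      card_farther[OF assms assms] assms
    by (simp add: sphere_Suc sphere_0)
next
  case (Suc m)
  have "v \<noteq> u" if "v \<in> sphere u (Suc m)" for v
    using that assms by (auto simp: sphere_def)
  moreover have "sphere u (Suc m) \<subseteq> V" by (auto simp: sphere_def)
  ultimately have "card {w. adj v w \<and> D u w = Suc (D u v)} = q" if "v \<in> sphere u (Suc m)" for v
    using that card_farther[OF assms, of v] by auto
  then show ?case
    unfolding sphere_Suc[OF assms, of "Suc m"]
    using card_UN_farther[OF assms, of "sphere u (Suc m)" "\<lambda>v. {w. adj v w \<and> D u w = Suc (D u v)}" q]
      Suc \<open>sphere u (Suc m) \<subseteq> V\<close>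
    by (simp add: mult.left_commute)
qed

lemma finite_sphere: "u \<in> V \<Longrightarrow> finite (sphere u m)"
  using card_sphere_Suc[of u "m - 1"] by (cases m) (auto simp: sphere_0)

section \<open>Distances controlled by a function on the vertices\<close>

lemma lipschitz_of_adj:
  fixes f :: "'a \<Rightarrow> real"
  assumes "\<And>v w. adj v w \<Longrightarrow> f v - f w \<le> 1" and "v \<in> V" "w \<in> V"
  shows "f v - f w \<le> real (D v w)"
  using assms(3)
proof (induction "D v w" arbitrary: w)
  case 0
  then have "v = w" using dist_eq_0_iff[OF assms(2)] by metis
  then show ?case using assms(2) by simp
next
  case (Suc m)
  then have "v \<noteq> w" using assms(2) by auto
  then obtain x where x: "adj w x" "D v w = Suc (D v x)"
    using closer_neighbour_exists[OF assms(2) Suc.prems] by metis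
  then have "f v - f x \<le> real (D v x)" using Suc.hyps in_arcsD2 by force
  moreover have "f x - f w \<le> 1" using assms(1) adj_sym x by blast
  ultimately show ?case using x(2) by simp
qed

text \<open>Each step adds at most 1 to the distance from \<open>v\<close> and lowers
  \<open>f\<close> by exactly 1. This turns descending chains of the flow into the cost bound that
  \<open>W1_eqI\<close> requires.\<close>

lemma dist_le_descent:
  fixes f :: "'a \<Rightarrow> real"
  assumes "(\<lambda>v w. adj v w \<and> f v = f w + 1)\<^sup>*\<^sup>* v w" "v \<in> V"
  shows "w \<in> V \<and> real (D v w) \<le> f v - f w"
  using assms(1)
proof induction
  case (step x w)
  then show ?case using dist_adj_le[OF assms(2), of x w] in_arcsD2 by auto
qed (use assms(2) in simp)

end

section \<open>Projection to a geodesic\<close>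

locale regular_tree_pair = regular_tree_graph q T
  for q :: nat and T :: "'a pair_pre_digraph" +
  fixes X Y :: 'a
  assumes X: "X \<in> V" and Y: "Y \<in> V" and X_neq_Y: "X \<noteq> Y"
begin

abbreviation d :: nat where "d \<equiv> D X Y"

lemma d_pos: "0 < d"
  using dist_eq_0_iff[OF X Y] X_neq_Y by simp

lemma d_le: "v \<in> V \<Longrightarrow> d \<le> D X v + D Y v"
  using dist_triangle[OF X _ Y, of v] dist_commute[OF Y, of v] by simp

text \<open>An edge leading away from \<open>X\<close> and towards \<open>Y\<close> lies on the
  geodesic. The next step towards \<open>Y\<close> cannot approach \<open>X\<close>, since
  \<open>v\<close> is the only neighbour of \<open>w\<close> closer to \<open>X\<close>; hence the
  sum of the distances stays constant until \<open>Y\<close> is reached.\<close>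

lemma dist_sum_eq_d:
  assumes "adj v w" "D X w = Suc (D X v)" "D Y v = Suc (D Y w)"
  shows "D X v + D Y v = d"
  using assms
proof (induction "D Y w" arbitrary: v w)
  case 0
  then have "w = Y" using dist_eq_0_iff[OF Y] in_arcsD2 by metis
  then show ?case using 0 by simp
next
  case (Suc m)
  have V: "w \<in> V" using Suc in_arcsD2 by auto
  moreover have "Y \<noteq> w" using Suc.hyps(2) Y by auto
  ultimately obtain x where x: "adj w x" "D Y w = Suc (D Y x)"
    using closer_neighbour_exists[OF Y] by metis
  have "x \<noteq> v" using x Suc.prems(3) by auto
  then have "D X w \<noteq> Suc (D X x)"
    using closer_neighbour_unique[OF X x(1) adj_sym[OF Suc.prems(1)]] Suc.prems(2) by auto
  then have "D X x = Suc (D X w)" using dist_adj_cases[OF X x(1)] by metis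
  then have "D X w + D Y w = d" using Suc.hyps x by simp
  then show ?case using Suc.prems by simp
qed

text \<open>
  The vertices of \<open>layer i h\<close> are those whose nearest point on the geodesic from \<open>X\<close> to \<open>Y\<close> is its
  \<open>i\<close>-th vertex, at distance \<open>h\<close>.
\<close>

definition layer :: "nat \<Rightarrow> nat \<Rightarrow> 'a set" where
  "layer i h = {v \<in> V. D X v = i + h \<and> D Y v = d - i + h}"

text \<open>Existence: a step towards \<open>Y\<close> must lead away from \<open>X\<close> by the
  triangle inequality. Uniqueness: the predecessor of any candidate lies in the previous layer, so
  it is \<open>v\<close>, and \<open>v\<close> has only one neighbour closer to
  \<open>Y\<close>.\<close>

lemma layer_0:
  assumes "i \<le> d"
  shows "\<exists>v. layer i 0 = {v}"
  using assms
proof (induction i)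
  case 0
  have "layer 0 0 = {X}"
    using dist_commute[OF X Y] X Y by (auto simp: layer_def dist_eq_0_iff)
  then show ?case by blast
next
  case (Suc i)
  then obtain v where v: "layer i 0 = {v}" by auto
  then have v': "v \<in> V" "D X v = i" "D Y v = d - i" by (auto simp: layer_def)
  have "Y \<noteq> v" using v' Suc.prems Y by auto
  then obtain w where w: "adj v w" "D Y v = Suc (D Y w)"
    using closer_neighbour_exists[OF Y v'(1)] by metis
  have wV: "w \<in> V" using w in_arcsD2 by auto
  have "w \<in> layer (Suc i) 0"
    using w v' wV d_le[OF wV] dist_adj_le[OF X w(1)] Suc.prems by (auto simp: layer_def)
  moreover have "w' = w" if "w' \<in> layer (Suc i) 0" for w'
  proof -
    have w': "w' \<in> V" "D X w' = Suc i" "D Y w' = d - Suc i" using that by (auto simp: layer_def)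
    then have "X \<noteq> w'" using X by auto
    then obtain v' where x: "adj w' v'" "D X w' = Suc (D X v')"
      using closer_neighbour_exists[OF X w'(1)] by metis
    have xV: "v' \<in> V" using x in_arcsD2 by auto
    have "v' \<in> layer i 0"
      using x w' xV d_le[OF xV] dist_adj_le[OF Y x(1)] Suc.prems by (auto simp: layer_def)
    then have "v' = v" using v by simp
    then show ?thesis
      using closer_neighbour_unique[OF Y w(1) adj_sym[OF x(1)[unfolded \<open>v' = v\<close>]] w(2)] w' v' Suc.prems
      by (metis Suc_diff_Suc Suc_le_lessD \<open>D Y v = d - i\<close>)
  qed
  ultimately show ?case by blast
qed

text \<open>The neighbour of \<open>w\<close> closer to \<open>X\<close> is also closer to
  \<open>Y\<close>; otherwise \<open>dist_sum_eq_d\<close> would put it on the geodesic, where its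
  distances add up to only \<open>d\<close>.\<close>

lemma layer_Suc:
  assumes "i \<le> d"
  shows "layer i (Suc h) =
    (\<Union>v\<in>layer i h. {w. adj v w \<and> D X w = Suc (D X v) \<and> D Y w = Suc (D Y v)})" (is "_ = ?R")
proof (intro equalityI subsetI)
  fix w assume "w \<in> layer i (Suc h)"
  then have w: "w \<in> V" "D X w = i + Suc h" "D Y w = d - i + Suc h" by (auto simp: layer_def)
  then have "X \<noteq> w" using X by auto
  then obtain v where v: "adj w v" "D X w = Suc (D X v)"
    using closer_neighbour_exists[OF X w(1)] by metis
  have "D Y v \<noteq> Suc (D Y w)"
    using dist_sum_eq_d[OF adj_sym[OF v(1)] v(2)] v w assms by auto
  then have "D Y w = Suc (D Y v)" using dist_adj_cases[OF Y v(1)] by metis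
  then show "w \<in> ?R"
    using v w in_arcsD2 by (auto simp: layer_def intro: adj_sym)
qed (use in_arcsD2 in \<open>auto simp: layer_def\<close>)

text \<open>The neighbours left out are those closer to \<open>X\<close> (the set \<open>A\<close>)
  or to \<open>Y\<close> (the set \<open>B\<close>). On the geodesic these are disjoint, with one of
  them empty at an end; off the geodesic they are the same singleton.\<close>

lemma card_both_farther:
  assumes "i \<le> d" "v \<in> layer i h"
  shows "card {w. adj v w \<and> D X w = Suc (D X v) \<and> D Y w = Suc (D Y v)} =
    (if h = 0 \<and> 0 < i \<and> i < d then q - 1 else q)" (is "card ?W = _")
proof -
  have v: "v \<in> V" "D X v = i + h" "D Y v = d - i + h" using assms by (auto simp: layer_def)
  define A where "A = {w. adj v w \<and> D X v = Suc (D X w)}"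
  define B where "B = {w. adj v w \<and> D Y v = Suc (D Y w)}"
  have fin: "finite A" "finite B" "finite ?W"
    by (auto intro: finite_subset[OF _ finite_nbrs[OF v(1)]] simp: A_def B_def)
  have cards: "card A = (if v = X then 0 else 1)" "card B = (if v = Y then 0 else 1)"
    unfolding A_def B_def by (rule card_closer[OF X v(1)], rule card_closer[OF Y v(1)])
  have "nbrs v = ?W \<union> (A \<union> B)"
    using dist_adj_cases[OF X, of v] dist_adj_cases[OF Y, of v] unfolding A_def B_def by blast
  moreover have "?W \<inter> (A \<union> B) = {}" by (auto simp: A_def B_def)
  ultimately have "card ?W + card (A \<union> B) = q + 1"
    using card_nbrs[OF v(1)] fin card_Un_disjoint[of ?W "A \<union> B"] by simp
  moreover have "v = X \<longleftrightarrow> h = 0 \<and> i = 0"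
    using dist_eq_0_iff[OF X v(1)] v by auto
  moreover have "v = Y \<longleftrightarrow> h = 0 \<and> i = d"
    using dist_eq_0_iff[OF Y v(1)] v assms by auto
  moreover have "A \<inter> B = {}" if "h = 0"
  proof (rule ccontr)
    assume "A \<inter> B \<noteq> {}"
    then obtain w where w: "adj v w" "D X v = Suc (D X w)" "D Y v = Suc (D Y w)"
      by (auto simp: A_def B_def)
    then show False using v d_le[of w] in_arcsD2[of v w] that assms by auto
  qed
  moreover have "A = B" if "h \<noteq> 0"
  proof (intro equalityI subsetI)
    fix w assume w: "w \<in> A"
    then have "D Y w \<noteq> Suc (D Y v)"
      using dist_sum_eq_d[of w v] adj_sym[of v w] that v assms by (auto simp: A_def)
    with w show "w \<in> B" using dist_adj_cases[OF Y, of v w] by (auto simp: A_def B_def)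
  next
    fix w assume w: "w \<in> B"
    then have "D X w \<noteq> Suc (D X v)"
      using dist_sum_eq_d[of v w] that v assms by (auto simp: B_def)
    with w show "w \<in> A" using dist_adj_cases[OF X, of v w] by (auto simp: A_def B_def)
  qed
  ultimately show ?thesis
    using cards card_Un_disjoint[OF fin(1,2)] d_pos assms by (cases "h = 0") (auto split: if_splits)
qed

text \<open>An end of the geodesic has \<open>q\<close> neighbours off it, an interior vertex
  \<open>q - 1\<close>; farther out each vertex has \<open>q\<close> children.\<close>

definition layer_card :: "nat \<Rightarrow> nat \<Rightarrow> nat" where
  "layer_card i h = (if i = 0 \<or> i = d then q ^ h else if h = 0 then 1 else (q - 1) * q ^ (h - 1))"

lemma card_layer:
  assumes "i \<le> d"
  shows "finite (layer i h) \<and> card (layer i h) = layer_card i h"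
proof (induction h)
  case 0
  then show ?case using layer_0[OF assms] by (auto simp: layer_card_def)
next
  case (Suc h)
  let ?W = "\<lambda>v. {w. adj v w \<and> D X w = Suc (D X v) \<and> D Y w = Suc (D Y v)}"
    and ?m = "if h = 0 \<and> 0 < i \<and> i < d then q - 1 else q"
  have "layer i h \<subseteq> V" by (auto simp: layer_def)
  then have "finite (\<Union>v\<in>layer i h. ?W v)" "card (\<Union>v\<in>layer i h. ?W v) = ?m * card (layer i h)"
    using card_UN_farther[OF X, of "layer i h" ?W ?m] card_both_farther[OF assms] Suc by blast+
  moreover have "?m * layer_card i h = layer_card i (Suc h)"
    using assms by (cases h) (auto simp: layer_card_def)
  ultimately show ?case
    unfolding layer_Suc[OF assms] using Suc by simp
qed

lemma layer_cover:
  assumes "v \<in> V"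
  shows "\<exists>i\<le>d. \<exists>h. v \<in> layer i h"
  using assms
proof (induction "D X v" arbitrary: v)
  case 0
  then have "v = X" using dist_eq_0_iff[OF X] by metis
  then have "v \<in> layer 0 0" using X Y dist_commute by (auto simp: layer_def)
  then show ?case by blast
next
  case (Suc m)
  then have "X \<noteq> v" using X by auto
  then obtain w where w: "adj v w" "D X v = Suc (D X w)"
    using closer_neighbour_exists[OF X Suc.prems] by metis
  then have "w \<in> V" using in_arcsD2 by auto
  then obtain i h where ih: "i \<le> d" "w \<in> layer i h"
    using Suc.hyps(1)[of w] Suc.hyps(2) w by auto
  from Y w(1) show ?case
  proof (rule dist_adj_cases)
    assume "D Y v = Suc (D Y w)"
    then have "v \<in> layer i (Suc h)" using w ih Suc.prems by (auto simp: layer_def)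
    then show ?thesis using ih by blast
  next
    assume dw: "D Y w = Suc (D Y v)"
    \<comment> \<open>The edge from \<open>w\<close> to \<open>v\<close> leads towards
      \<open>Y\<close>, so \<open>w\<close> is on the geodesic and \<open>v\<close> is its next
      vertex. In the other case \<open>v\<close> is one higher in the branch of
      \<open>w\<close>.\<close>
    then have "D X w + D Y w = d" using dist_sum_eq_d[OF adj_sym[OF w(1)]] w by simp
    then have "h = 0" "i < d" using ih dw by (auto simp: layer_def)
    then have "v \<in> layer (Suc i) 0" using dw w ih Suc.prems by (auto simp: layer_def)
    then show ?thesis using \<open>i < d\<close> Suc_leI by blast
  qed
qed

section \<open>Finite neighbourhoods of the geodesic\<close>

definition region :: "nat \<Rightarrow> 'a set" where
  "region H = (\<Union>i\<le>d. \<Union>h\<le>H. layer i h)"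

lemma finite_region: "finite (region H)"
  using card_layer by (auto simp: region_def)

lemma region_subset: "region H \<subseteq> V"
  by (auto simp: region_def layer_def)

text \<open>The height of a vertex above the geodesic is at most its distance to either end.\<close>

lemma in_region:
  assumes "v \<in> V" "D X v \<le> H \<or> D Y v \<le> H"
  shows "v \<in> region H"
proof -
  obtain i h where "i \<le> d" "v \<in> layer i h" using layer_cover assms by blast
  with assms show ?thesis by (force simp: region_def layer_def)
qed

lemma sum_region:
  fixes F :: "nat \<Rightarrow> nat \<Rightarrow> real"
  shows "(\<Sum>v\<in>region H. F (D X v) (D Y v)) =
    (\<Sum>i\<le>d. \<Sum>h\<le>H. real (layer_card i h) * F (i + h) (d - i + h))"
proof -
  have "(\<Sum>v\<in>region H. F (D X v) (D Y v)) =
      (\<Sum>i\<le>d. \<Sum>v\<in>(\<Union>h\<le>H. layer i h). F (D X v) (D Y v))"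
    unfolding region_def
    by (rule sum.UNION_disjoint) (use card_layer in \<open>auto simp: layer_def\<close>)
  also have "\<dots> = (\<Sum>i\<le>d. \<Sum>h\<le>H. \<Sum>v\<in>layer i h. F (D X v) (D Y v))"
    by (intro sum.cong refl sum.UNION_disjoint) (use card_layer in \<open>auto simp: layer_def\<close>)
  also have "\<dots> = (\<Sum>i\<le>d. \<Sum>h\<le>H. \<Sum>v\<in>layer i h. F (i + h) (d - i + h))"
    by (intro sum.cong refl) (auto simp: layer_def)
  also have "\<dots> = (\<Sum>i\<le>d. \<Sum>h\<le>H. real (layer_card i h) * F (i + h) (d - i + h))"
    by (intro sum.cong refl) (simp add: card_layer)
  finally show ?thesis .
qed

end

section \<open>Radial measures\<close>

locale radial_pair = regular_tree_pair q T X Y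
  for q :: nat and T :: "'a pair_pre_digraph" and X Y :: 'a +
  fixes g :: "nat \<Rightarrow> real" and \<mu> \<nu> :: "'a pmf" and L :: nat
  assumes q_pos: "0 < q"
    and set_\<mu>: "set_pmf \<mu> \<subseteq> V" and set_\<nu>: "set_pmf \<nu> \<subseteq> V"
    and pmf_\<mu>: "\<And>v. v \<in> V \<Longrightarrow> pmf \<mu> v = g (D X v)"
    and pmf_\<nu>: "\<And>v. v \<in> V \<Longrightarrow> pmf \<nu> v = g (D Y v)"
    and support: "\<And>v. v \<in> set_pmf \<mu> \<Longrightarrow> D X v \<le> L"
begin

text \<open>Every distance occurs, so properties of the probabilities carry over to all values of
  \<open>g\<close>.\<close>

lemma sphere_nonempty: "u \<in> V \<Longrightarrow> sphere u m \<noteq> {}"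
  using card_sphere_Suc[of u "m - 1"] q_pos by (cases m) (auto simp: sphere_0)

lemma g_nonneg: "0 \<le> g m"
proof -
  obtain v where "v \<in> V" "D X v = m" using sphere_nonempty[OF X, of m] by (auto simp: sphere_def)
  then show ?thesis using pmf_\<mu> pmf_nonneg by metis
qed

lemma g_eq_0: "L < m \<Longrightarrow> g m = 0"
proof -
  assume "L < m"
  obtain v where v: "v \<in> V" "D X v = m" using sphere_nonempty[OF X, of m] by (auto simp: sphere_def)
  then have "v \<notin> set_pmf \<mu>" using support \<open>L < m\<close> by fastforce
  then show "g m = 0" using v pmf_\<mu> by (metis pmf_eq_0_set_pmf)
qed

text \<open>The mass of a branch whose root is at distance \<open>m\<close> from the centre of the measure.\<close>

definition branch_mass :: "nat \<Rightarrow> real" where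
  "branch_mass m = (\<Sum>j=m..L. real q ^ (j - m) * g j)"

lemma branch_mass_rec: "branch_mass m = g m + real q * branch_mass (Suc m)"
proof (cases "m \<le> L")
  case True
  have "branch_mass m = g m + (\<Sum>j=Suc m..L. real q ^ (j - m) * g j)"
    unfolding branch_mass_def using True by (subst sum.atLeast_Suc_atMost) auto
  also have "(\<Sum>j=Suc m..L. real q ^ (j - m) * g j) = (\<Sum>j=Suc m..L. real q * (real q ^ (j - Suc m) * g j))"
  proof (rule sum.cong)
    fix j assume "j \<in> {Suc m..L}"
    then have "j - m = Suc (j - Suc m)" by auto
    then show "real q ^ (j - m) * g j = real q * (real q ^ (j - Suc m) * g j)" by simp
  qed simp
  finally show ?thesis by (simp add: branch_mass_def sum_distrib_left)
qed (simp add: branch_mass_def g_eq_0)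

lemma branch_mass_nonneg: "0 \<le> branch_mass m"
  by (auto simp: branch_mass_def intro!: sum_nonneg mult_nonneg_nonneg g_nonneg)

lemma branch_mass_antimono:
  assumes "m \<le> n"
  shows "branch_mass n \<le> branch_mass m"
proof (rule lift_Suc_antimono_le[OF _ assms])
  fix m
  have "1 * branch_mass (Suc m) \<le> real q * branch_mass (Suc m)"
    by (intro mult_right_mono branch_mass_nonneg) (use q_pos in simp)
  then show "branch_mass (Suc m) \<le> branch_mass m"
    using branch_mass_rec[of m] g_nonneg[of m] by simp
qed

lemma branch_mass_eq_0: "L < m \<Longrightarrow> branch_mass m = 0"
  by (simp add: branch_mass_def)

lemma total_mass: "g 0 + real (q + 1) * branch_mass 1 = 1"
proof -
  have "1 = (\<Sum>v\<in>(\<Union>m\<le>L. sphere X m). pmf \<mu> v)"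
    by (rule sum_pmf_eq_1[symmetric])
      (use support set_\<mu> finite_sphere[OF X] in \<open>auto simp: sphere_def\<close>)
  also have "\<dots> = (\<Sum>m\<le>L. \<Sum>v\<in>sphere X m. pmf \<mu> v)"
    by (rule sum.UNION_disjoint) (use finite_sphere[OF X] in \<open>auto simp: sphere_def\<close>)
  also have "\<dots> = (\<Sum>m\<le>L. \<Sum>v\<in>sphere X m. g m)"
    by (intro sum.cong refl) (auto simp: sphere_def pmf_\<mu>)
  also have "\<dots> = (\<Sum>m\<in>{0..L}. real (card (sphere X m)) * g m)"
    by (simp add: atMost_atLeast0)
  also have "\<dots> = g 0 + (\<Sum>m=1..L. real (card (sphere X m)) * g m)"
    using X by (subst sum.atLeast_Suc_atMost) (auto simp: sphere_0)
  also have "(\<Sum>m=1..L. real (card (sphere X m)) * g m) =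
      (\<Sum>m=1..L. real (q + 1) * (real q ^ (m - 1) * g m))"
  proof (rule sum.cong)
    fix m assume "m \<in> {1..L}"
    then have "m = Suc (m - 1)" by auto
    then have "card (sphere X m) = (q + 1) * q ^ (m - 1)"
      using card_sphere_Suc[OF X, of "m - 1"] by metis
    then show "real (card (sphere X m)) * g m = real (q + 1) * (real q ^ (m - 1) * g m)"
      by (simp add: algebra_simps)
  qed simp
  finally show ?thesis by (simp add: branch_mass_def sum_distrib_left)
qed

lemma branch_mass_le_half: "branch_mass (Suc m) \<le> 1 / 2"
proof -
  have "2 * branch_mass 1 \<le> real (q + 1) * branch_mass 1"
    by (intro mult_right_mono branch_mass_nonneg) (use q_pos in simp)
  then have "branch_mass 1 \<le> 1 / 2" using total_mass g_nonneg[of 0] by simp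
  then show ?thesis using branch_mass_antimono[of 1 "Suc m"] by simp
qed

text \<open>
  The mass that the radial measure centred at \<open>u\<close> puts on the side of \<open>v\<close>
  when the edge between \<open>v\<close> and \<open>w\<close> is removed.
\<close>

definition side_mass :: "'a \<Rightarrow> 'a \<Rightarrow> 'a \<Rightarrow> real" where
  "side_mass u v w = (if D u v = Suc (D u w) then branch_mass (D u v) else 1 - branch_mass (D u w))"

lemma side_mass_swap: "u \<in> V \<Longrightarrow> adj v w \<Longrightarrow> side_mass u w v = 1 - side_mass u v w"
  by (rule dist_adj_cases[of u v w]) (auto simp: side_mass_def)

text \<open>Removing \<open>v\<close> splits the rest of the tree into the sides of its neighbours,
  which carry all mass except that of \<open>v\<close>. The computation rests on
  \<open>total_mass\<close> at the centre and on \<open>branch_mass_rec\<close> elsewhere.\<close>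

lemma sum_side_mass:
  assumes "u \<in> V" "v \<in> V"
  shows "(\<Sum>w\<in>nbrs v. side_mass u w v) = 1 - g (D u v)"
proof -
  let ?A = "{w. adj v w \<and> D u v = Suc (D u w)}" and ?B = "{w. adj v w \<and> D u w = Suc (D u v)}"
  have un: "nbrs v = ?A \<union> ?B"
    using dist_adj_cases[OF assms(1)] by blast
  have fin: "finite ?A" "finite ?B" by (auto intro: finite_subset[OF _ finite_nbrs[OF assms(2)]])
  have "(\<Sum>w\<in>nbrs v. side_mass u w v) = (\<Sum>w\<in>?A. side_mass u w v) + (\<Sum>w\<in>?B. side_mass u w v)"
    unfolding un by (rule sum.union_disjoint[OF fin]) auto
  also have "(\<Sum>w\<in>?A. side_mass u w v) = (\<Sum>w\<in>?A. 1 - branch_mass (D u v))"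
    by (intro sum.cong) (auto simp: side_mass_def)
  also have "(\<Sum>w\<in>?B. side_mass u w v) = (\<Sum>w\<in>?B. branch_mass (Suc (D u v)))"
    by (intro sum.cong) (auto simp: side_mass_def)
  finally have "(\<Sum>w\<in>nbrs v. side_mass u w v) =
      real (card ?A) * (1 - branch_mass (D u v)) + real (card ?B) * branch_mass (Suc (D u v))"
    by (simp only: sum_constant)
  then show ?thesis
    unfolding card_closer[OF assms] card_farther[OF assms]
    using branch_mass_rec[of "D u v"] total_mass assms by (cases "v = u") auto
qed

text \<open>The excess of \<open>\<mu>\<close> over \<open>\<nu>\<close> on the side of
  \<open>v\<close> has to leave through the edge, so a positive value means flow from
  \<open>v\<close> to \<open>w\<close>.\<close>

definition net_flow :: "'a \<Rightarrow> 'a \<Rightarrow> real" where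
  "net_flow v w = side_mass X v w - side_mass Y v w"

text \<open>The signed distance to the midpoint of the geodesic, but \<open>0\<close> on all branches off it at a midpoint vertex.\<close>

definition potential :: "'a \<Rightarrow> real" where
  "potential v = (if D X v < D Y v then real (D Y v) - real d / 2
    else if D Y v < D X v then real d / 2 - real (D X v) else 0)"

text \<open>Of the four combinations of signs, the two mixed ones occur only on the
  geodesic.\<close>

lemma edge_cases [consumes 1, case_names outward inward to_Y to_X]:
  assumes "adj v w"
  obtains "D X w = Suc (D X v)" "D Y w = Suc (D Y v)"
    | "D X v = Suc (D X w)" "D Y v = Suc (D Y w)"
    | "D X w = Suc (D X v)" "D Y v = Suc (D Y w)" "D X v + D Y v = d"
    | "D X v = Suc (D X w)" "D Y w = Suc (D Y v)" "D X w + D Y w = d"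
  using dist_adj_cases[OF X assms] dist_adj_cases[OF Y assms]
    dist_sum_eq_d[OF assms] dist_sum_eq_d[OF adj_sym[OF assms]]
  by metis

lemma potential_adj: "adj v w \<Longrightarrow> potential v - potential w \<le> 1"
  by (cases rule: edge_cases[of v w]) (auto simp: potential_def)

text \<open>Off the geodesic the sign of the flow compares \<open>branch_mass\<close> at the two
  distances, and monotonicity tells which of \<open>X\<close> and \<open>Y\<close> is strictly
  nearer. On the geodesic, flow towards \<open>X\<close> would need two branches of total mass above
  1, each having at most 1/2.\<close>

lemma potential_descent:
  assumes "adj v w" "0 < net_flow v w"
  shows "potential v = potential w + 1"
  using assms(1)
proof (cases rule: edge_cases)
  case outward
  then have "branch_mass (D X w) < branch_mass (D Y w)"
    using assms(2) by (simp add: net_flow_def side_mass_def)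
  then have "D Y w < D X w" using branch_mass_antimono[of "D X w" "D Y w"] by linarith
  then show ?thesis using outward by (simp add: potential_def)
next
  case inward
  then have "branch_mass (D Y v) < branch_mass (D X v)"
    using assms(2) by (simp add: net_flow_def side_mass_def)
  then have "D X v < D Y v" using branch_mass_antimono[of "D Y v" "D X v"] by linarith
  then show ?thesis using inward by (simp add: potential_def)
next
  case to_Y
  then show ?thesis by (auto simp: potential_def)
next
  case to_X
  then have "branch_mass (D X v) + branch_mass (D Y w) > 1"
    using assms(2) by (simp add: net_flow_def side_mass_def)
  then show ?thesis
    using to_X branch_mass_le_half[of "D X w"] branch_mass_le_half[of "D Y v"] by simp
qed

text \<open>Off the geodesic the flow is a difference of branch masses, which both vanish beyond
  distance \<open>L\<close>; on the geodesic the distances are at most \<open>d\<close>.\<close>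

lemma net_flow_support:
  assumes "adj v w" "net_flow v w \<noteq> 0"
  shows "v \<in> region (L + d) \<and> w \<in> region (L + d)"
proof -
  have V: "v \<in> V" "w \<in> V" using assms in_arcsD1 in_arcsD2 by auto
  have "(D X v \<le> L + d \<or> D Y v \<le> L + d) \<and> (D X w \<le> L + d \<or> D Y w \<le> L + d)"
    using assms(1)
  proof (cases rule: edge_cases)
    case outward
    then have "D X w \<le> L \<or> D Y w \<le> L"
      using assms(2) branch_mass_eq_0[of "D X w"] branch_mass_eq_0[of "D Y w"]
      by (fastforce simp: net_flow_def side_mass_def)
    then show ?thesis using outward by auto
  next
    case inward
    then have "D X v \<le> L \<or> D Y v \<le> L"
      using assms(2) branch_mass_eq_0[of "D X v"] branch_mass_eq_0[of "D Y v"]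
      by (fastforce simp: net_flow_def side_mass_def)
    then show ?thesis using inward by auto
  qed auto
  then show ?thesis using in_region V by blast
qed

lemma sum_net_flow:
  assumes "v \<in> V"
  shows "(\<Sum>w\<in>nbrs v. net_flow v w) = pmf \<mu> v - pmf \<nu> v"
proof -
  have "net_flow v w = side_mass Y w v - side_mass X w v" if "w \<in> nbrs v" for w
    using that side_mass_swap[OF X, of v w] side_mass_swap[OF Y, of v w] by (simp add: net_flow_def)
  then have "(\<Sum>w\<in>nbrs v. net_flow v w) = (\<Sum>w\<in>nbrs v. side_mass Y w v - side_mass X w v)"
    by (intro sum.cong) auto
  then show ?thesis
    using sum_side_mass[OF X assms] sum_side_mass[OF Y assms] pmf_\<mu>[OF assms] pmf_\<nu>[OF assms]
    by (simp add: sum_subtractf)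
qed

lemma rel_pmf_potential_descent:
  "rel_pmf (\<lambda>v w. adj v w \<and> potential v = potential w + 1)\<^sup>*\<^sup>* \<mu> \<nu>"
proof (rule flow_imp_rel_pmf[where f = potential and B = "region (L + d)"
    and \<phi> = "\<lambda>v w. if adj v w then max 0 (net_flow v w) else 0"])
  let ?\<phi> = "\<lambda>v w. if adj v w then max 0 (net_flow v w) else 0"
  fix v
  show "pmf \<mu> v - pmf \<nu> v = (\<Sum>w\<in>region (L + d). ?\<phi> v w) - (\<Sum>w\<in>region (L + d). ?\<phi> w v)"
  proof (cases "v \<in> V")
    case True
    have anti: "net_flow w v = - net_flow v w" if "adj v w" for w
      using that side_mass_swap[OF X, of v w] side_mass_swap[OF Y, of v w] by (simp add: net_flow_def)
    \<comment> \<open>By antisymmetry at most one of the two positive parts is nonzero, and their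
      difference is the signed flow.\<close>
    have "?\<phi> v w - ?\<phi> w v = (if adj v w then net_flow v w else 0)" for w
      using anti[of w] adj_sym[of v w] adj_sym[of w v] by auto
    then have "(\<Sum>w\<in>region (L + d). ?\<phi> v w) - (\<Sum>w\<in>region (L + d). ?\<phi> w v) =
        (\<Sum>w\<in>region (L + d). if adj v w then net_flow v w else 0)"
      by (simp flip: sum_subtractf)
    also have "\<dots> = (\<Sum>w\<in>region (L + d) \<inter> nbrs v. net_flow v w)"
      by (subst sum.inter_restrict[OF finite_region]) simp
    also have "\<dots> = (\<Sum>w\<in>nbrs v. net_flow v w)"
      by (rule sum.mono_neutral_left)
        (use net_flow_support finite_nbrs[OF True] in auto)
    finally show ?thesis using sum_net_flow[OF True] by simp
  next
    case False
    then have "pmf \<mu> v = 0" "pmf \<nu> v = 0" using set_\<mu> set_\<nu> by (auto simp: pmf_eq_0_set_pmf)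
    moreover have "\<not> adj v w" "\<not> adj w v" for w using False in_arcsD1 in_arcsD2 by auto
    ultimately show ?thesis by simp
  qed
next
  fix v w assume "(if adj v w then max 0 (net_flow v w) else 0) \<noteq> 0"
  then have "adj v w" "0 < net_flow v w" by (auto split: if_splits)
  then show "v \<in> region (L + d) \<and> w \<in> region (L + d) \<and> adj v w \<and> potential v = potential w + 1"
    using net_flow_support potential_descent by auto
qed (auto simp: finite_region)

lemma support_\<nu>: "v \<in> set_pmf \<nu> \<Longrightarrow> D Y v \<le> L"
  using g_eq_0[of "D Y v"] pmf_\<nu>[of v] set_\<nu> by (force simp: set_pmf_iff)

section \<open>The Wasserstein distance as a finite sum\<close>

lemma W1_eq_sum_region:
  "W1 T \<mu> \<nu> = (\<Sum>v\<in>region (L + d). potential v * (g (D X v) - g (D Y v)))"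
proof -
  have sub: "set_pmf \<mu> \<subseteq> region (L + d)" "set_pmf \<nu> \<subseteq> region (L + d)"
    using in_region[of _ "L + d"] support support_\<nu> set_\<mu> set_\<nu> by (auto simp: subset_iff trans_le_add1)
  have "W1 T \<mu> \<nu> = measure_pmf.expectation \<mu> potential - measure_pmf.expectation \<nu> potential"
  proof (rule W1_eqI)
    show "finite (set_pmf \<mu>)" "finite (set_pmf \<nu>)" using sub finite_region finite_subset by blast+
    show "potential v - potential w \<le> real (D v w)" if "v \<in> set_pmf \<mu>" "w \<in> set_pmf \<nu>" for v w
      using that set_\<mu> set_\<nu> by (intro lipschitz_of_adj potential_adj) auto
    show "rel_pmf (\<lambda>v w. real (D v w) \<le> potential v - potential w) \<mu> \<nu>"
      using rel_pmf_potential_descent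
      by (rule pmf.rel_mono_strong) (use dist_le_descent[of potential] set_\<mu> in blast)
  qed
  also have "measure_pmf.expectation \<mu> potential = (\<Sum>v\<in>region (L + d). potential v * pmf \<mu> v)"
    by (rule integral_measure_pmf_real) (use sub finite_region in auto)
  also have "\<dots> = (\<Sum>v\<in>region (L + d). potential v * g (D X v))"
    using region_subset by (intro sum.cong) (auto simp: pmf_\<mu> subset_iff)
  also have "measure_pmf.expectation \<nu> potential = (\<Sum>v\<in>region (L + d). potential v * pmf \<nu> v)"
    by (rule integral_measure_pmf_real) (use sub finite_region in auto)
  also have "\<dots> = (\<Sum>v\<in>region (L + d). potential v * g (D Y v))"
    using region_subset by (intro sum.cong) (auto simp: pmf_\<nu> subset_iff)
  finally show ?thesis by (simp add: sum_subtractf right_diff_distrib)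
qed

end

section \<open>Evaluation as three series\<close>

lemma sum_symmetric_halves:
  fixes Z :: "nat \<Rightarrow> real"
  assumes sym: "\<And>i. i \<le> d \<Longrightarrow> Z (d - i) = Z i" and mid: "\<And>i. 2 * i = d \<Longrightarrow> Z i = 0"
  shows "(\<Sum>i\<le>d. Z i) = 2 * (\<Sum>i\<le>d div 2. Z i)"
proof -
  have un: "{..d} = {..d div 2} \<union> {d div 2<..d}" by auto
  have "(\<Sum>i\<le>d. Z i) = (\<Sum>i\<le>d div 2. Z i) + (\<Sum>i\<in>{d div 2<..d}. Z i)"
    unfolding un by (rule sum.union_disjoint) auto
  also have "(\<Sum>i\<in>{d div 2<..d}. Z i) = (\<Sum>i<d - d div 2. Z i)"
    by (rule sum.reindex_bij_witness[where i = "\<lambda>i. d - i" and j = "\<lambda>i. d - i"]) (auto simp: sym)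
  \<comment> \<open>For odd \<open>d\<close> the two index sets agree; for even \<open>d\<close> the
    left one misses the midpoint, whose term is zero.\<close>
  also have "\<dots> = (\<Sum>i\<le>d div 2. Z i)"
    by (rule sum.mono_neutral_left) (auto intro!: mid)
  finally show ?thesis by simp
qed

context radial_pair begin

lemma W1_eq_series:
  "W1 T \<mu> \<nu> =
      2 * (\<Sum>h. real q ^ h * (g h - g (h + d)) * (real d / 2 + real h))
    + 2 * (\<Sum>i = 1..d div 2. (g i - g (d - i)) * (real d / 2 - real i))
    + 2 * (\<Sum>i = 1..d div 2. \<Sum>h. if h \<ge> 1
             then (real q - 1) * real q ^ (h - 1) * (g (i + h) - g (d - i + h))
                    * (real d / 2 - real i + real h)
             else 0)"
proof -
  define pot where "pot a b = (if a < b then real b - real d / 2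
    else if b < a then real d / 2 - real a else 0)" for a b :: nat
  define H where "H = L + d"
  define t where "t i h = real (layer_card i h) * (pot (i + h) (d - i + h) * (g (i + h) - g (d - i + h)))" for i h
  define Z where "Z i = (\<Sum>h\<le>H. t i h)" for i
  have "W1 T \<mu> \<nu> = (\<Sum>v\<in>region H. pot (D X v) (D Y v) * (g (D X v) - g (D Y v)))"
    unfolding W1_eq_sum_region H_def by (simp add: potential_def pot_def)
  also have "\<dots> = (\<Sum>i\<le>d. Z i)"
    using sum_region[where F = "\<lambda>a b. pot a b * (g a - g b)"] by (simp add: Z_def t_def)
  also have "\<dots> = 2 * (\<Sum>i\<le>d div 2. Z i)"
  proof (rule sum_symmetric_halves)
    \<comment> \<open>Reflecting \<open>i\<close> to \<open>d - i\<close> exchanges the two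
      distances. This flips the sign of \<open>pot\<close> and of the difference of
      \<open>g\<close>, so \<open>t\<close> is unchanged.\<close>
    have pot: "pot b a = - pot a b" for a b by (simp add: pot_def)
    have "t (d - i) h = t i h" if "i \<le> d" for i h
    proof -
      have "layer_card (d - i) h = layer_card i h" using that d_pos by (auto simp: layer_card_def)
      then show ?thesis
        using that pot[of "d - i + h" "i + h"] by (simp add: t_def algebra_simps)
    qed
    then show "Z (d - i) = Z i" if "i \<le> d" for i using that by (simp add: Z_def)
    show "Z i = 0" if "2 * i = d" for i
    proof -
      have "d - i = i" using that by simp
      then show ?thesis by (simp add: Z_def t_def)
    qed
  qed
  also have "(\<Sum>i\<le>d div 2. Z i) = Z 0 + (\<Sum>i=1..d div 2. Z i)"
    unfolding atMost_atLeast0 by (subst sum.atLeast_Suc_atMost) auto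
  also have "Z 0 = (\<Sum>h. real q ^ h * (g h - g (h + d)) * (real d / 2 + real h))"
  proof -
    have "t 0 h = real q ^ h * (g h - g (h + d)) * (real d / 2 + real h)" for h
      using d_pos by (simp add: t_def layer_card_def pot_def add.commute field_simps)
    then show ?thesis
      unfolding Z_def by (subst suminf_finite[of "{..H}"]) (auto simp: g_eq_0 H_def)
  qed
  also have "(\<Sum>i=1..d div 2. Z i) =
      (\<Sum>i = 1..d div 2. (g i - g (d - i)) * (real d / 2 - real i)
        + (\<Sum>h. if h \<ge> 1
             then (real q - 1) * real q ^ (h - 1) * (g (i + h) - g (d - i + h))
                    * (real d / 2 - real i + real h)
             else 0))"
  proof (rule sum.cong)
    fix i assume "i \<in> {1..d div 2}"
    then have i: "0 < i" "i < d" "2 * i \<le> d" by auto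
    define s where "s h = (if h \<ge> 1
       then (real q - 1) * real q ^ (h - 1) * (g (i + h) - g (d - i + h)) * (real d / 2 - real i + real h)
       else 0)" for h
    \<comment> \<open>At the midpoint \<open>pot\<close> is \<open>0\<close> while the factor on the
      right is \<open>h\<close>; both sides vanish there because the two values of \<open>g\<close>
      coincide.\<close>
    have diff: "pot (i + h) (d - i + h) * (g (i + h) - g (d - i + h)) =
        (g (i + h) - g (d - i + h)) * (real d / 2 - real i + real h)" for h
    proof (cases "2 * i = d")
      case True
      then have "d - i = i" by simp
      then show ?thesis by simp
    next
      case False
      then show ?thesis using i by (auto simp: pot_def of_nat_diff)
    qed
    have "t i h = (if h = 0 then (g i - g (d - i)) * (real d / 2 - real i) else 0) + s h" for h
      unfolding t_def diff using i q_pos by (cases h) (auto simp: layer_card_def s_def of_nat_diff)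
    then have "Z i = (g i - g (d - i)) * (real d / 2 - real i) + (\<Sum>h\<le>H. s h)"
      by (simp add: Z_def sum.distrib)
    also have "(\<Sum>h\<le>H. s h) = (\<Sum>h. s h)"
      by (rule suminf_finite[symmetric]) (auto simp: s_def g_eq_0 H_def)
    finally show "Z i = (g i - g (d - i)) * (real d / 2 - real i) + (\<Sum>h. if h \<ge> 1
             then (real q - 1) * real q ^ (h - 1) * (g (i + h) - g (d - i + h))
                    * (real d / 2 - real i + real h)
             else 0)"
      by (simp only: s_def)
  qed simp
  finally show ?thesis by (simp add: sum.distrib)
qed

end

theorem theorem5p1:
  fixes q d n :: nat
    and T :: "'a pair_pre_digraph"
    and \<mu> :: "'a \<Rightarrow> nat \<Rightarrow> 'a pmf"
    and g :: "nat \<Rightarrow> nat \<Rightarrow> real"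
    and X Y :: 'a
  assumes "q \<ge> 2" and "d \<ge> 1"
    and "regular_tree (q + 1) T"
    and "\<And>u n. u \<in> pverts T \<Longrightarrow> set_pmf (\<mu> u n) \<subseteq> pverts T"
    and "\<And>u n. u \<in> pverts T \<Longrightarrow> finite (set_pmf (\<mu> u n))"
    and "\<And>u v u' v' n. u \<in> pverts T \<Longrightarrow> v \<in> pverts T \<Longrightarrow> u' \<in> pverts T \<Longrightarrow> v' \<in> pverts T \<Longrightarrow>
           graph_dist T u v = graph_dist T u' v' \<Longrightarrow> pmf (\<mu> u n) v = pmf (\<mu> u' n) v'"
    and "\<And>u v n. u \<in> pverts T \<Longrightarrow> v \<in> pverts T \<Longrightarrow> g (graph_dist T u v) n = pmf (\<mu> u n) v"
    and "X \<in> pverts T" and "Y \<in> pverts T" and "graph_dist T X Y = d"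
  shows "W1 T (\<mu> X n) (\<mu> Y n) =
      2 * (\<Sum>h. real q ^ h * (g h n - g (h + d) n) * (real d / 2 + real h))
    + 2 * (\<Sum>i = 1..d div 2. (g i n - g (d - i) n) * (real d / 2 - real i))
    + 2 * (\<Sum>i = 1..d div 2. \<Sum>h. if h \<ge> 1
             then (real q - 1) * real q ^ (h - 1) * (g (i + h) n - g (d - i + h) n)
                    * (real d / 2 - real i + real h)
             else 0)"
proof -
  interpret regular_tree_graph q T
    by unfold_locales fact
  \<comment> \<open>A radius for the support of \<open>\<mu> X n\<close>; it also serves
    \<open>\<mu> Y n\<close>, since both measures share \<open>g\<close>.\<close>
  define L where "L = Max (graph_dist T X ` set_pmf (\<mu> X n))"
  have "X \<noteq> Y" using assms(2,8,10) by auto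
  interpret radial_pair q T X Y "\<lambda>m. g m n" "\<mu> X n" "\<mu> Y n" L
  proof
    show "graph_dist T X v \<le> L" if "v \<in> set_pmf (\<mu> X n)" for v
      using that assms(5)[OF assms(8)] by (simp add: L_def)
    show "0 < q" using assms(1) by simp
    show "pmf (\<mu> X n) v = g (graph_dist T X v) n" "pmf (\<mu> Y n) v = g (graph_dist T Y v) n"
      if "v \<in> pverts T" for v
      by (simp_all only: assms(7)[OF assms(8) that] assms(7)[OF assms(9) that])
  qed (fact assms(8,9) \<open>X \<noteq> Y\<close> assms(4)[OF assms(8)] assms(4)[OF assms(9)])+
  show ?thesis
    using W1_eq_series unfolding \<open>graph_dist T X Y = d\<close> .
qed

end
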